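(* Let $X=X_\sigma$ be a three-dimensional affine toric variety associated to a nondegenerate cone $\sigma\subseteq N_{\mathbb{R}}$, where $N$ has rank $3$. If $X$ admits a moderate toric resolution, then it is a minimal terminal $\mathbb{Q}$-factorial model of $X$. That is, every moderate toric resolution $X_\Sigma\to X_\sigma$ is a minimal terminal $\mathbb{Q}$-factorial model of $X_\sigma$.
   Context: Let $M$ and $N$ be free abelian groups of rank $d$ dual to each other, $N_{\mathbb{R}}=N\otimes\mathbb{R}$, $M_{\mathbb{R}}=M\otimes\mathbb{R}$, and $k$ an arbitrary field. A cone in $N_{\mathbb{R}}$ means a strongly convex, rational polyhedral cone. It is nondegenerate if it is $d$-dimensional. For a cone $\sigma$ with dual cone $\sigma^\vee\subseteq M_{\mathbb{R}}$, $X_\sigma=\operatorname{Spec} k[\sigma^\vee\cap M]$; for a fan $\Sigma$, $X_\Sigma$ is the associated toric variety. Each one-dimensional cone $\rho$ contains a unique primitive element $P(\rho)\in\rho\cap N$; $\operatorname{Gen}(\tau)$ denotes the set of the $P(\rho)$ for $\rho$ the one-dimensional faces of a cone $\tau$ (the minimal generators of $\tau$). A cone is smooth if its minimal generators form part of a $\mathbb{Z}$-basis of $N$, and simplicial if its minimal generators are linearly independent. A subdivision of $\sigma$ is a (finite) fan whose support is $\sigma$. Moderate toric resolution: a subdivision $\Sigma$ of a nondegenerate cone $\sigma\subseteq N_{\mathbb{R}}$ is a moderate toric resolution of $\sigma$ if every nondegenerate cone $\tau$ of $\Sigma$ is smooth and the affine hyperplane $\{x\in N_{\mathbb{R}}\mid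 l_\tau(x)=1\}$ spanned by $\operatorname{Gen}(\tau)$ intersects every one-dimensional face of $\sigma$, where $l_\tau:N_{\mathbb{R}}\to\mathbb{R}$ is the linear function sending each minimal generator of $\tau$ to $1$. The induced morphism $X_\Sigma\to X_\sigma$ is also called a moderate toric resolution. Minimal terminal $\mathbb{Q}$-factorial models: a simplicial cone $\tau$ is terminal (i.e. $X_\tau$ has terminal singularities) if the only elements of $N$ in the convex hull of $\{0\}\cup\operatorname{Gen}(\tau)$ are $0$ and the elements of $\operatorname{Gen}(\tau)$. Let $\Sigma_{\mathrm{c}}$ be the subdivision of $\sigma$ consisting of $\{0\}$ and the cones generated by the bounded faces of the convex hull $\operatorname{Conv}(\sigma\cap N\setminus\{0\})$; $X_{\Sigma_{\mathrm{c}}}$ is the canonical model of $X_\sigma$. The minimal terminal $\mathbb{Q}$-factorial models of $X_\sigma$ are the toric varieties $X_{\Sigma}\to X_\sigma$ where $\Sigma$ is a subdivision of the fan $\Sigma_{\mathrm{c}}$ into simplicial terminal cones whose minimal generators belong to the bounded faces of $\operatorname{Conv}(\sigma\cap N\setminus\{0\})$. *)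

theory Defs
  imports "HOL-Analysis.Analysis"
begin

text \<open>
  The space \<open>N\<^sub>\<real>\<close> is a Euclidean space \<open>'a\<close>, and \<open>N\<close> is a full-rank lattice in it; its rank is
  \<open>DIM('a)\<close>. The inner product of \<open>'a\<close> plays no role. A toric variety over \<open>X\<^sub>\<sigma>\<close> is
  represented by its fan, a set of cones in \<open>'a\<close>.
\<close>

definition lattice_basis :: "'a::euclidean_space set \<Rightarrow> 'a set \<Rightarrow> bool" where
  "lattice_basis N B \<longleftrightarrow>
     independent B \<and> span B = UNIV \<and>
     N = range (\<lambda>c :: 'a \<Rightarrow> int. \<Sum>b\<in>B. of_int (c b) *\<^sub>R b)"

definition is_lattice :: "'a::euclidean_space set \<Rightarrow> bool" where
  "is_lattice N \<longleftrightarrow> (\<exists>B. lattice_basis N B)"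

definition toric_cone :: "'a::euclidean_space set \<Rightarrow> 'a set \<Rightarrow> bool" where
  "toric_cone N \<sigma> \<longleftrightarrow>
     (\<exists>S. finite S \<and> S \<subseteq> N \<and> \<sigma> = convex_cone hull S) \<and>
     (\<forall>x. x \<in> \<sigma> \<and> - x \<in> \<sigma> \<longrightarrow> x = 0)"

definition nondegenerate :: "'a::euclidean_space set \<Rightarrow> bool" where
  "nondegenerate \<sigma> \<longleftrightarrow> dim \<sigma> = DIM('a)"

text \<open>
  The faces of a polyhedral cone are its nonempty faces as a convex set (\<open>face_of\<close> admits \<open>{}\<close>).
\<close>

definition cone_faces :: "'a::euclidean_space set \<Rightarrow> 'a set set" where
  "cone_faces \<sigma> = {\<tau>. \<tau> face_of \<sigma> \<and> \<tau> \<noteq> {}}"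

definition rays :: "'a::euclidean_space set \<Rightarrow> 'a set set" where
  "rays \<sigma> = {\<rho> \<in> cone_faces \<sigma>. dim \<rho> = 1}"

definition primitive_in :: "'a::euclidean_space set \<Rightarrow> 'a \<Rightarrow> bool" where
  "primitive_in N v \<longleftrightarrow>
     v \<in> N \<and> v \<noteq> 0 \<and> (\<forall>w\<in>N. \<forall>n::nat. v = of_nat n *\<^sub>R w \<longrightarrow> n = 1)"

definition ray_generator :: "'a::euclidean_space set \<Rightarrow> 'a set \<Rightarrow> 'a" where
  "ray_generator N \<rho> = (THE v. v \<in> \<rho> \<and> primitive_in N v)"

definition Gen :: "'a::euclidean_space set \<Rightarrow> 'a set \<Rightarrow> 'a set" where
  "Gen N \<tau> = ray_generator N ` rays \<tau>"

definition smooth_cone :: "'a::euclidean_space set \<Rightarrow> 'a set \<Rightarrow> bool" where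
  "smooth_cone N \<tau> \<longleftrightarrow> (\<exists>B. lattice_basis N B \<and> Gen N \<tau> \<subseteq> B)"

definition simplicial_cone :: "'a::euclidean_space set \<Rightarrow> 'a set \<Rightarrow> bool" where
  "simplicial_cone N \<tau> \<longleftrightarrow> independent (Gen N \<tau>)"

definition terminal_cone :: "'a::euclidean_space set \<Rightarrow> 'a set \<Rightarrow> bool" where
  "terminal_cone N \<tau> \<longleftrightarrow> N \<inter> convex hull (insert 0 (Gen N \<tau>)) = insert 0 (Gen N \<tau>)"

definition fan :: "'a::euclidean_space set \<Rightarrow> 'a set set \<Rightarrow> bool" where
  "fan N \<Sigma> \<longleftrightarrow>
     finite \<Sigma> \<and>
     (\<forall>\<tau>\<in>\<Sigma>. toric_cone N \<tau>) \<and>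
     (\<forall>\<tau>\<in>\<Sigma>. cone_faces \<tau> \<subseteq> \<Sigma>) \<and>
     (\<forall>\<tau>\<in>\<Sigma>. \<forall>\<tau>'\<in>\<Sigma>. \<tau> \<inter> \<tau>' \<in> cone_faces \<tau> \<and> \<tau> \<inter> \<tau>' \<in> cone_faces \<tau>')"

definition subdivision :: "'a::euclidean_space set \<Rightarrow> 'a set \<Rightarrow> 'a set set \<Rightarrow> bool" where
  "subdivision N \<sigma> \<Sigma> \<longleftrightarrow> fan N \<Sigma> \<and> \<Union>\<Sigma> = \<sigma>"

definition fan_subdivision ::
    "'a::euclidean_space set \<Rightarrow> 'a set set \<Rightarrow> 'a set set \<Rightarrow> bool" where
  "fan_subdivision N \<Sigma>' \<Sigma> \<longleftrightarrow>
     fan N \<Sigma> \<and> \<Union>\<Sigma> = \<Union>\<Sigma>' \<and> (\<forall>\<tau>\<in>\<Sigma>. \<exists>\<kappa>\<in>\<Sigma>'. \<tau> \<subseteq> \<kappa>)"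

text \<open>
  For a smooth nondegenerate \<open>\<tau>\<close> the generators form a basis of the space, so
  the function \<open>l\<^sub>\<tau>\<close> exists and is unique.
\<close>

definition gen_form :: "'a::euclidean_space set \<Rightarrow> 'a set \<Rightarrow> 'a \<Rightarrow> real" where
  "gen_form N \<tau> = (THE l. linear l \<and> (\<forall>v\<in>Gen N \<tau>. l v = 1))"

definition moderate_toric_resolution ::
    "'a::euclidean_space set \<Rightarrow> 'a set \<Rightarrow> 'a set set \<Rightarrow> bool" where
  "moderate_toric_resolution N \<sigma> \<Sigma> \<longleftrightarrow>
     subdivision N \<sigma> \<Sigma> \<and>
     (\<forall>\<tau>\<in>\<Sigma>. nondegenerate \<tau> \<longrightarrow>
        smooth_cone N \<tau> \<and> (\<forall>\<rho>\<in>rays \<sigma>. {x. gen_form N \<tau> x = 1} \<inter> \<rho> \<noteq> {}))"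

definition bounded_faces :: "'a::euclidean_space set \<Rightarrow> 'a set \<Rightarrow> 'a set set" where
  "bounded_faces N \<sigma> =
     {F. F face_of (convex hull (\<sigma> \<inter> N - {0})) \<and> F \<noteq> {} \<and> bounded F}"

definition canonical_fan :: "'a::euclidean_space set \<Rightarrow> 'a set \<Rightarrow> 'a set set" where
  "canonical_fan N \<sigma> = insert {0} ((\<lambda>F. convex_cone hull F) ` bounded_faces N \<sigma>)"

definition minimal_terminal_model ::
    "'a::euclidean_space set \<Rightarrow> 'a set \<Rightarrow> 'a set set \<Rightarrow> bool" where
  "minimal_terminal_model N \<sigma> \<Sigma> \<longleftrightarrow>
     fan_subdivision N (canonical_fan N \<sigma>) \<Sigma> \<and>
     (\<forall>\<tau>\<in>\<Sigma>. simplicial_cone N \<tau> \<and> terminal_cone N \<tau> \<and>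
            Gen N \<tau> \<subseteq> \<Union>(bounded_faces N \<sigma>))"

end

theory Submission
  imports Defs
begin

text \<open>
  Let \<open>\<tau>\<close> be a nondegenerate cone of the resolution and \<open>l\<close> the linear form that is \<open>1\<close> on its
  minimal generators. Since \<open>\<tau>\<close> is smooth and of full dimension, these generators form a basis of
  the lattice, so \<open>l\<close> takes integral values on \<open>N\<close>. The hyperplane \<open>l = 1\<close> meets every ray of
  \<open>\<sigma>\<close>, so \<open>l\<close> is positive on \<open>\<sigma>\<close> away from the origin. Integrality and positivity together give
  \<open>l \<ge> 1\<close> on the nonzero lattice points of \<open>\<sigma>\<close>, and hence on their convex hull \<open>P\<close>. Therefore
  \<open>l = 1\<close> is a supporting hyperplane of \<open>P\<close>; it cuts out a face that contains \<open>Gen N \<tau>\<close> and is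
  bounded because \<open>l\<close> is positive on \<open>\<sigma>\<close> off the origin
  (\<open>moderate_Gen_in_bounded_face\<close>). A cone is generated by its minimal generators
  (\<open>toric_cone_eq_hull_Gen\<close>), so \<open>\<tau>\<close> lies in the cone over this face, a cone of the canonical fan.

  Every other cone of the resolution is a face of a nondegenerate one
  (\<open>fan_cone_face_of_nondegenerate\<close>) and inherits smoothness and the position of its generators
  from it. Smooth cones are simplicial, and they are terminal because the simplex spanned by the
  origin and part of a lattice basis has no lattice points except its vertices
  (\<open>smooth_imp_terminal\<close>).
\<close>

section \<open>Convex cones and their extreme rays\<close>

lemma cone_hull_singleton: "convex_cone hull {v} = {t *\<^sub>R v | t. 0 \<le> t}"
proof (rule hull_unique)
  show "{v} \<subseteq> {t *\<^sub>R v | t. 0 \<le> t}"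
    by (auto intro: exI[of _ 1])
  show "convex_cone {t *\<^sub>R v | t. 0 \<le> t}"
    unfolding convex_cone_iff
  proof (intro conjI ballI allI impI)
    show "0 \<in> {t *\<^sub>R v | t. 0 \<le> t}" by (auto intro: exI[of _ 0])
  next
    fix x y assume "x \<in> {t *\<^sub>R v | t. 0 \<le> t}" "y \<in> {t *\<^sub>R v | t. 0 \<le> t}"
    then obtain a b where "0 \<le> a" "x = a *\<^sub>R v" "0 \<le> b" "y = b *\<^sub>R v" by auto
    then show "x + y \<in> {t *\<^sub>R v | t. 0 \<le> t}"
      by (auto simp: scaleR_add_left intro!: exI[of _ "a + b"])
  next
    fix x and c :: real assume "x \<in> {t *\<^sub>R v | t. 0 \<le> t}" "0 \<le> c"
    then obtain a where "0 \<le> a" "x = a *\<^sub>R v" by auto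
    with \<open>0 \<le> c\<close> show "c *\<^sub>R x \<in> {t *\<^sub>R v | t. 0 \<le> t}"
      by (auto intro!: exI[of _ "c * a"])
  qed
  show "{t *\<^sub>R v | t. 0 \<le> t} \<subseteq> T" if "{v} \<subseteq> T" "convex_cone T" for T
    using that by (auto simp: convex_cone_scaleR)
qed

lemma cone_hull_insert:
  assumes "x \<in> convex_cone hull (insert v S)"
  obtains t y where "0 \<le> t" "y \<in> convex_cone hull S" "x = t *\<^sub>R v + y"
proof -
  have "x \<in> convex_cone hull ({v} \<union> S)" using assms by simp
  then show ?thesis
    unfolding convex_cone_hull_Un by (auto simp: cone_hull_singleton intro: that)
qed

lemma dim_cone_hull_singleton:
  fixes v :: "'a::euclidean_space"
  assumes "v \<noteq> 0"
  shows "dim (convex_cone hull {v}) = 1"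
proof -
  have "convex_cone hull {v} \<subseteq> span {v}"
    by (auto simp: cone_hull_singleton intro: span_base span_scale)
  moreover have "{v} \<subseteq> span (convex_cone hull {v})"
    by (simp add: span_base hull_inc)
  ultimately have "span (convex_cone hull {v}) = span {v}"
    by (simp add: span_eq)
  then have "dim (convex_cone hull {v}) = dim {v}" by (rule span_eq_dim)
  then show ?thesis using assms by simp
qed

text \<open>
  Deleting redundant generators one at a time ends at a generating set in which no element is
  redundant.
\<close>

lemma irredundant_generators:
  assumes "finite S"
  obtains S' where "S' \<subseteq> S" "convex_cone hull S' = convex_cone hull S"
    "\<And>v. v \<in> S' \<Longrightarrow> v \<notin> convex_cone hull (S' - {v})"
proof -
  have "\<exists>S'\<subseteq>S. convex_cone hull S' = convex_cone hull S \<and>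
          (\<forall>v\<in>S'. v \<notin> convex_cone hull (S' - {v}))"
    using assms
  proof (induction S rule: finite_psubset_induct)
    case (psubset S)
    show ?case
    proof (cases "\<exists>v\<in>S. v \<in> convex_cone hull (S - {v})")
      case True
      then obtain v where v: "v \<in> S" "v \<in> convex_cone hull (S - {v})" by blast
      then have eq: "convex_cone hull (S - {v}) = convex_cone hull S"
        using hull_redundant by (metis insert_Diff)
      have "S - {v} \<subset> S" using v by blast
      from psubset.IH[OF this] eq show ?thesis by auto
    qed auto
  qed
  then show ?thesis using that by blast
qed

text \<open>
  If \<open>a + b\<close> lies on the ray of \<open>v\<close>, split off the \<open>v\<close>-parts of \<open>a\<close> and \<open>b\<close>. What remains of
  the sum is a multiple of \<open>v\<close> in the cone of the other generators: a positive multiple would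
  make \<open>v\<close> redundant, and a nonpositive one forces the remainders to vanish, by pointedness.
\<close>

lemma irredundant_generator_spans_face:
  fixes S :: "'a::euclidean_space set"
  assumes pointed: "\<forall>x. x \<in> convex_cone hull S \<and> - x \<in> convex_cone hull S \<longrightarrow> x = 0"
    and v: "v \<in> S" and irr: "v \<notin> convex_cone hull (S - {v})"
  shows "convex_cone hull {v} face_of convex_cone hull S"
proof -
  let ?C = "convex_cone hull S" and ?D = "convex_cone hull (S - {v})"
  have DC: "?D \<subseteq> ?C" by (intro hull_mono) auto
  have vC: "v \<in> ?C" using v by (rule hull_inc)
  have key: "a \<in> convex_cone hull {v} \<and> b \<in> convex_cone hull {v}"
    if a: "a \<in> ?C" and b: "b \<in> ?C" and ab: "a + b = t *\<^sub>R v" for a b t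
  proof -
    have ins: "insert v (S - {v}) = S" using v by auto
    obtain \<alpha> a' where a': "0 \<le> \<alpha>" "a' \<in> ?D" "a = \<alpha> *\<^sub>R v + a'"
      using a cone_hull_insert[of a v "S - {v}"] ins by metis
    obtain \<beta> b' where b': "0 \<le> \<beta>" "b' \<in> ?D" "b = \<beta> *\<^sub>R v + b'"
      using b cone_hull_insert[of b v "S - {v}"] ins by metis
    define r where "r = t - \<alpha> - \<beta>"
    have sum: "a' + b' = r *\<^sub>R v"
      using ab a' b' by (simp add: r_def algebra_simps)
    have sumD: "a' + b' \<in> ?D" using a' b' by (simp add: convex_cone_hull_add)
    have "r \<le> 0"
    proof (rule ccontr)
      assume "\<not> r \<le> 0"
      then have "v = (1 / r) *\<^sub>R (a' + b')" and "0 \<le> 1 / r" using sum by auto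
      with sumD have "v \<in> ?D" by (metis convex_cone_hull_mul)
      with irr show False by simp
    qed
    have neg: "(- r) *\<^sub>R v \<in> ?C" using vC \<open>r \<le> 0\<close> by (intro convex_cone_hull_mul) auto
    have "- a' = b' + (- r) *\<^sub>R v" "- b' = a' + (- r) *\<^sub>R v"
      using sum by (auto simp: algebra_simps neg_eq_iff_add_eq_0 eq_neg_iff_add_eq_0)
    then have "- a' \<in> ?C" "- b' \<in> ?C"
      using neg DC a' b' convex_cone_hull_add by (metis subsetD)+
    then have "a' = 0" "b' = 0" using pointed DC a' b' by blast+
    then show ?thesis using a' b' by (auto simp: cone_hull_singleton)
  qed
  show ?thesis
    unfolding face_of_def
  proof (intro conjI ballI impI)
    show "convex_cone hull {v} \<subseteq> ?C" using v by (intro hull_mono) auto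
    show "convex (convex_cone hull {v})" by (rule convex_convex_cone_hull)
    fix a b x
    assume a: "a \<in> ?C" and b: "b \<in> ?C" and x: "x \<in> convex_cone hull {v}"
      and seg: "x \<in> open_segment a b"
    obtain u where u: "0 < u" "u < 1" "x = (1 - u) *\<^sub>R a + u *\<^sub>R b"
      using seg by (auto simp: in_segment)
    obtain t where "x = t *\<^sub>R v" using x by (auto simp: cone_hull_singleton)
    then have "(1 - u) *\<^sub>R a \<in> convex_cone hull {v} \<and> u *\<^sub>R b \<in> convex_cone hull {v}"
      using u a b by (intro key[of _ _ t] convex_cone_hull_mul) auto
    then have "(1 / (1 - u)) *\<^sub>R (1 - u) *\<^sub>R a \<in> convex_cone hull {v}"
      "(1 / u) *\<^sub>R u *\<^sub>R b \<in> convex_cone hull {v}"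
      using u by (auto intro!: convex_cone_hull_mul simp del: scaleR_scaleR)
    then show "a \<in> convex_cone hull {v}" "b \<in> convex_cone hull {v}"
      using u by auto
  qed
qed

text \<open>
  The sum \<open>a + b\<close> is the midpoint of \<open>2a\<close> and \<open>2b\<close>; the case \<open>a = b\<close> is separate because the
  open segment is then empty.
\<close>

lemma face_of_convex_coneD:
  fixes C :: "'a::euclidean_space set"
  assumes C: "convex_cone C" and F: "F face_of C"
    and a: "a \<in> C" and b: "b \<in> C" and ab: "a + b \<in> F"
  shows "a \<in> F" and "b \<in> F"
proof -
  have "2 *\<^sub>R a \<in> F \<and> 2 *\<^sub>R b \<in> F"
  proof (cases "a = b")
    case True
    with ab show ?thesis by (simp add: scaleR_2)
  next
    case False
    have "a + b = (1 - 1/2) *\<^sub>R (2 *\<^sub>R a) + (1/2) *\<^sub>R (2 *\<^sub>R b)" by simp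
    with False have "a + b \<in> open_segment (2 *\<^sub>R a) (2 *\<^sub>R b)"
      unfolding in_segment by (intro conjI exI[of _ "1/2"]) auto
    moreover have "2 *\<^sub>R a \<in> C" "2 *\<^sub>R b \<in> C" using C a b by (simp_all add: convex_cone_scaleR)
    ultimately show ?thesis using face_ofD[OF F] ab by blast
  qed
  moreover have "conic F"
    using face_of_conic[OF _ F] C by (simp add: convex_cone_def)
  ultimately have "(1/2) *\<^sub>R (2 *\<^sub>R a) \<in> F" "(1/2) *\<^sub>R (2 *\<^sub>R b) \<in> F"
    by (auto intro!: conic_mul simp del: scaleR_scaleR)
  then show "a \<in> F" "b \<in> F" by simp_all
qed

lemma face_generated_by_contained_generators:
  fixes S :: "'a::euclidean_space set"
  assumes F: "F face_of convex_cone hull S" and ne: "F \<noteq> {}"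
  shows "F = convex_cone hull (S \<inter> F)"
proof
  let ?C = "convex_cone hull S" and ?D = "convex_cone hull (S \<inter> F)"
  have C: "convex_cone ?C" by (rule convex_cone_convex_cone_hull)
  have con: "conic F" using face_of_conic[OF conic_convex_cone_hull F] .
  define T where "T = {x \<in> ?C. x \<in> F \<longrightarrow> x \<in> ?D}"
  have add: "x + y \<in> T" if "x \<in> T" "y \<in> T" for x y
  proof -
    have xy: "x \<in> ?C" "y \<in> ?C" using that by (simp_all add: T_def)
    have "x + y \<in> ?D" if sum: "x + y \<in> F"
    proof -
      have "x \<in> F" "y \<in> F" using face_of_convex_coneD[OF C F xy sum] .
      then show ?thesis
        using \<open>x \<in> T\<close> \<open>y \<in> T\<close> by (intro convex_cone_hull_add) (simp_all add: T_def)
    qed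
    then show ?thesis using convex_cone_hull_add[OF xy] by (simp add: T_def)
  qed
  have scale: "c *\<^sub>R x \<in> T" if x: "x \<in> T" and c: "0 \<le> c" for x and c :: real
  proof -
    have "c *\<^sub>R x \<in> ?D" if "c *\<^sub>R x \<in> F"
    proof (cases "c = 0")
      case False
      then have "x \<in> F" using conic_mul[OF con that, of "1 / c"] c by simp
      then show ?thesis using x c by (simp add: T_def convex_cone_hull_mul)
    qed (simp add: convex_cone_hull_contains_0)
    then show ?thesis using x c by (simp add: T_def convex_cone_hull_mul)
  qed
  have "0 \<in> T" by (simp add: T_def convex_cone_hull_contains_0)
  with add scale have "convex_cone T" unfolding convex_cone_iff by blast
  moreover have "S \<subseteq> T" by (auto simp: T_def intro: hull_inc)
  ultimately have "?C \<subseteq> T" by (intro hull_minimal)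
  then show "F \<subseteq> ?D" using face_of_imp_subset[OF F] by (auto simp: T_def)
  have "convex_cone F"
    using ne con F face_of_imp_convex by (auto simp: convex_cone_def)
  then show "?D \<subseteq> F" by (intro hull_minimal) auto
qed

text \<open>
  The inequality \<open>norm x \<le> K * l x\<close> cuts out a convex cone, so it suffices to have it on the
  generators. It yields both the positivity of \<open>l\<close> off the origin and the boundedness of its
  level sets in the cone.
\<close>

lemma positive_functional_dominates_norm:
  fixes S :: "'a::euclidean_space set"
  assumes "finite S" and l: "linear l" and pos: "\<And>v. v \<in> S \<Longrightarrow> 0 < l v"
  obtains K :: real where "0 < K" "\<And>x. x \<in> convex_cone hull S \<Longrightarrow> norm x \<le> K * l x"
proof -
  define K where "K = 1 + (\<Sum>v\<in>S. norm v / l v)"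
  have nn: "0 \<le> norm v / l v" if "v \<in> S" for v using pos[OF that] by simp
  have K: "0 < K" unfolding K_def using nn by (intro add_pos_nonneg sum_nonneg) auto
  have gens: "norm v \<le> K * l v" if "v \<in> S" for v
  proof -
    have "norm v / l v \<le> K"
      unfolding K_def using member_le_sum[of v S "\<lambda>v. norm v / l v"] that nn \<open>finite S\<close> by simp
    then show ?thesis using pos[OF that] by (simp add: field_simps)
  qed
  have "convex_cone hull S \<subseteq> {x. norm x \<le> K * l x}"
  proof (rule hull_minimal)
    show "S \<subseteq> {x. norm x \<le> K * l x}" using gens by auto
    show "convex_cone {x. norm x \<le> K * l x}"
      unfolding convex_cone_iff
    proof (intro conjI ballI allI impI)
      show "0 \<in> {x. norm x \<le> K * l x}" using l by (simp add: linear_0)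
    next
      fix x y assume "x \<in> {x. norm x \<le> K * l x}" "y \<in> {x. norm x \<le> K * l x}"
      then show "x + y \<in> {x. norm x \<le> K * l x}"
        using l norm_triangle_ineq[of x y] by (simp add: linear_add distrib_left)
    next
      fix x and c :: real assume "x \<in> {x. norm x \<le> K * l x}" "0 \<le> c"
      then show "c *\<^sub>R x \<in> {x. norm x \<le> K * l x}"
        using l mult_left_mono[of "norm x" "K * l x" c] by (simp add: linear_scale mult_ac)
    qed
  qed
  with K that show ?thesis by blast
qed

section \<open>Lattices and primitive vectors\<close>

lemma lattice_basis_finite: "lattice_basis N B \<Longrightarrow> finite B"
  unfolding lattice_basis_def using independent_imp_finite by blast

lemma lattice_diff_int_multiple:
  assumes "is_lattice N" "x \<in> N" "y \<in> N"
  shows "x - of_int k *\<^sub>R y \<in> N"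
proof -
  obtain B where B: "N = range (\<lambda>c :: 'a \<Rightarrow> int. \<Sum>b\<in>B. of_int (c b) *\<^sub>R b)"
    using assms unfolding is_lattice_def lattice_basis_def by blast
  obtain c d :: "'a \<Rightarrow> int" where "x = (\<Sum>b\<in>B. of_int (c b) *\<^sub>R b)" "y = (\<Sum>b\<in>B. of_int (d b) *\<^sub>R b)"
    using assms B by blast
  then have "x - of_int k *\<^sub>R y = (\<Sum>b\<in>B. of_int (c b - k * d b) *\<^sub>R b)"
    by (simp add: scaleR_sum_right sum_subtractf scaleR_diff_left)
  then show ?thesis unfolding B by (rule range_eqI[where x = "\<lambda>b. c b - k * d b"])
qed

lemma lattice_zero: "is_lattice N \<Longrightarrow> 0 \<in> N"
  unfolding is_lattice_def lattice_basis_def by (auto intro!: range_eqI[of _ _ "\<lambda>_. 0"])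

lemma linear_Ints_on_lattice:
  assumes "lattice_basis N B" "linear l" "\<And>b. b \<in> B \<Longrightarrow> l b \<in> \<int>" "x \<in> N"
  shows "(l x :: real) \<in> \<int>"
proof -
  obtain c :: "'a \<Rightarrow> int" where "x = (\<Sum>b\<in>B. of_int (c b) *\<^sub>R b)"
    using assms unfolding lattice_basis_def by blast
  then have "l x = (\<Sum>b\<in>B. of_int (c b) * l b)"
    using assms(2) by (simp add: linear_sum linear_scale)
  then show ?thesis using assms(3) by (auto intro!: Ints_sum Ints_mult)
qed

lemma lattice_coordinate_functional:
  assumes "lattice_basis N B" "b \<in> B"
  obtains g :: "'a::euclidean_space \<Rightarrow> real" where "linear g" "g b = 1"
    "\<And>b'. b' \<in> B \<Longrightarrow> b' \<noteq> b \<Longrightarrow> g b' = 0" "\<And>x. x \<in> N \<Longrightarrow> g x \<in> \<int>"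
proof -
  have "independent B" using assms unfolding lattice_basis_def by blast
  from linear_independent_extend[OF this, of "\<lambda>b'. if b' = b then 1 else 0 :: real"]
  obtain g :: "'a \<Rightarrow> real" where g: "linear g" "\<And>b'. b' \<in> B \<Longrightarrow> g b' = (if b' = b then 1 else 0)"
    by blast
  have "g x \<in> \<int>" if "x \<in> N" for x
    using linear_Ints_on_lattice[OF assms(1) g(1) _ that] g(2) by simp
  then show ?thesis using g assms(2) by (intro that[of g]) auto
qed

text \<open>
  Some coordinate of \<open>s\<close> with respect to a lattice basis is nonzero; up to sign, that coordinate is
  the functional.
\<close>

lemma positive_integral_functional:
  fixes N :: "'a::euclidean_space set"
  assumes "is_lattice N" "s \<in> N" "s \<noteq> 0"
  obtains l :: "'a \<Rightarrow> real" where "linear l" "0 < l s" "\<And>x. x \<in> N \<Longrightarrow> l x \<in> \<int>"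
proof -
  obtain B where B: "lattice_basis N B" using assms unfolding is_lattice_def by blast
  obtain b g where b: "b \<in> B" "linear g" "g b = 1" "\<And>x. x \<in> N \<Longrightarrow> (g x :: real) \<in> \<int>" "g s \<noteq> 0"
  proof -
    obtain c :: "'a \<Rightarrow> int" where c: "s = (\<Sum>b\<in>B. of_int (c b) *\<^sub>R b)"
      using assms B unfolding lattice_basis_def by blast
    obtain b where b: "b \<in> B" "c b \<noteq> 0"
    proof (rule ccontr)
      assume "\<not> thesis"
      then have "\<forall>b\<in>B. c b = 0" using that by blast
      then have "s = 0" unfolding c by (intro sum.neutral) auto
      with assms(3) show False by simp
    qed
    obtain g where g: "linear g" "g b = 1" "\<And>b'. b' \<in> B \<Longrightarrow> b' \<noteq> b \<Longrightarrow> g b' = 0"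
      "\<And>x. x \<in> N \<Longrightarrow> (g x :: real) \<in> \<int>"
      using lattice_coordinate_functional[OF B b(1)] by metis
    have "g s = (\<Sum>b'\<in>B. of_int (c b') * g b')"
      using c g(1) by (simp add: linear_sum linear_scale)
    also have "\<dots> = (\<Sum>b'\<in>B. if b' = b then of_int (c b) else 0)"
      using g by (intro sum.cong) auto
    also have "\<dots> = of_int (c b)" using b lattice_basis_finite[OF B] by simp
    finally show ?thesis using that b g by force
  qed
  define l where "l x = sgn (g s) * g x" for x
  have "linear l" unfolding l_def using b(2)
    by (intro linearI) (auto simp: linear_add linear_scale algebra_simps)
  moreover have "0 < l s" using b(5) by (simp add: l_def sgn_if)
  moreover have "l x \<in> \<int>" if "x \<in> N" for x using b(4)[OF that] by (auto simp: l_def sgn_if)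
  ultimately show ?thesis using that by blast
qed

text \<open>
  Measure the lattice points of the ray by an integral functional that is positive on it. The
  lattice point of least positive value is the primitive one: for another lattice point
  \<open>r *\<^sub>R v\<close>, the point \<open>(r - \<lfloor>r\<rfloor>) *\<^sub>R v\<close> is again in the lattice and has a smaller value, so it
  is the origin and \<open>r\<close> is an integer.
\<close>

lemma ex1_primitive_in_ray:
  fixes N :: "'a::euclidean_space set"
  assumes N: "is_lattice N" and s: "s \<in> N" "s \<noteq> 0"
  shows "\<exists>!v. v \<in> convex_cone hull {s} \<and> primitive_in N v"
proof -
  obtain l :: "'a \<Rightarrow> real" where l: "linear l" "0 < l s" "\<And>x. x \<in> N \<Longrightarrow> l x \<in> \<int>"
    using positive_integral_functional[OF N s] by blast
  let ?R = "convex_cone hull {s}"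
  let ?P = "\<lambda>w. w \<in> ?R \<and> w \<in> N \<and> w \<noteq> 0"
  have lpos: "0 < l w" if "w \<in> ?R" "w \<noteq> 0" for w
    using that l by (auto simp: cone_hull_singleton linear_scale less_le)
  have "?P s" using s by (auto intro: hull_inc)
  then obtain v where v: "?P v" and least: "\<And>w. ?P w \<Longrightarrow> nat \<lfloor>l v\<rfloor> \<le> nat \<lfloor>l w\<rfloor>"
    using ex_has_least_nat[of ?P s "\<lambda>w. nat \<lfloor>l w\<rfloor>"] by blast
  have min: "l v \<le> l w" if "?P w" for w
    using least[OF that] lpos[of w] lpos[of v] that v l(3)[of v] l(3)[of w]
    by (auto elim!: Ints_cases)
  obtain q where q: "0 < q" "v = q *\<^sub>R s"
    using v by (auto simp: cone_hull_singleton less_le)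
  have mult: "\<exists>k::nat. w = of_nat k *\<^sub>R v" if w: "w \<in> ?R" "w \<in> N" for w
  proof -
    obtain p where p: "0 \<le> p" "w = p *\<^sub>R s" using w by (auto simp: cone_hull_singleton)
    define r where "r = p / q"
    have r: "0 \<le> r" "w = r *\<^sub>R v" using p q by (auto simp: r_def)
    let ?u = "(r - of_int \<lfloor>r\<rfloor>) *\<^sub>R v"
    have "?u \<in> N"
      using lattice_diff_int_multiple[OF N w(2), of v "\<lfloor>r\<rfloor>"] v r by (simp add: scaleR_diff_left)
    moreover have "?u \<in> ?R" using v by (intro convex_cone_hull_mul) auto
    moreover have "l ?u < l v"
    proof -
      have "r - of_int \<lfloor>r\<rfloor> < 1" by linarith
      then show ?thesis using lpos[of v] v l(1) by (simp add: linear_scale)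
    qed
    ultimately have "?u = 0" using min[of ?u] by fastforce
    then have "r = of_int \<lfloor>r\<rfloor>" using v by simp
    then have "r = of_nat (nat \<lfloor>r\<rfloor>)" using r by (metis of_nat_nat zero_le_floor of_int_of_nat_eq)
    then show ?thesis using r by metis
  qed
  show ?thesis
  proof
    have "n = 1" if w: "w \<in> N" and n: "v = of_nat n *\<^sub>R w" for w and n :: nat
    proof -
      have n0: "0 < n" "w \<noteq> 0" using v n by (auto intro: gr0I)
      then have "w = (1 / of_nat n) *\<^sub>R v" using n by simp
      then have "w \<in> ?R" using v convex_cone_hull_mul[of v "{s}" "1 / of_nat n"] by simp
      with min w n0 have "l v \<le> l w" by blast
      moreover have "l v = of_nat n * l w" using l(1) n by (simp add: linear_scale)
      moreover have "0 < l w" using lpos \<open>w \<in> ?R\<close> n0 by blast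
      ultimately have "of_nat n \<le> (1::real)"
        by (metis mult_le_cancel_right2 not_less_iff_gr_or_eq)
      then show ?thesis using n0 by simp
    qed
    then show "v \<in> ?R \<and> primitive_in N v" using v by (auto simp: primitive_in_def)
    fix w assume w: "w \<in> ?R \<and> primitive_in N w"
    then obtain k :: nat where k: "w = of_nat k *\<^sub>R v" using mult by (auto simp: primitive_in_def)
    then have "k = 1" using w v unfolding primitive_in_def by blast
    then show "w = v" using k by simp
  qed
qed

section \<open>The minimal generators of a cone\<close>

lemma toric_cone_convex_cone: "toric_cone N \<tau> \<Longrightarrow> convex_cone \<tau>"
  unfolding toric_cone_def using convex_cone_convex_cone_hull by blast

lemma toric_cone_closed: "toric_cone N \<tau> \<Longrightarrow> closed \<tau>"
  unfolding toric_cone_def using closed_convex_cone_hull by blast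

lemma toric_cone_generated_by_rays:
  assumes "toric_cone N \<tau>"
  obtains S where "finite S" "S \<subseteq> N" "\<tau> = convex_cone hull S"
    "\<And>v. v \<in> S \<Longrightarrow> convex_cone hull {v} \<in> rays \<tau>"
proof -
  obtain S\<^sub>0 where S0: "finite S\<^sub>0" "S\<^sub>0 \<subseteq> N" "\<tau> = convex_cone hull S\<^sub>0"
    and pointed: "\<forall>x. x \<in> \<tau> \<and> - x \<in> \<tau> \<longrightarrow> x = 0"
    using assms unfolding toric_cone_def by blast
  obtain S where S: "S \<subseteq> S\<^sub>0" "convex_cone hull S = convex_cone hull S\<^sub>0"
    "\<And>v. v \<in> S \<Longrightarrow> v \<notin> convex_cone hull (S - {v})"
    using irredundant_generators[OF S0(1)] by blast
  have eq: "\<tau> = convex_cone hull S" using S S0 by simp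
  have "convex_cone hull {v} \<in> rays \<tau>" if v: "v \<in> S" for v
  proof -
    have "v \<noteq> 0" using S(3)[OF v] convex_cone_hull_contains_0 by metis
    moreover have "convex_cone hull {v} face_of \<tau>"
      using irredundant_generator_spans_face[OF _ v S(3)[OF v]] pointed unfolding eq by blast
    ultimately show ?thesis
      by (simp add: rays_def cone_faces_def dim_cone_hull_singleton convex_cone_hull_nonempty)
  qed
  moreover have "finite S" "S \<subseteq> N" using S(1) S0(1,2) finite_subset by auto
  ultimately show ?thesis using that eq by simp
qed

lemma ray_spanned_by_lattice_vector:
  assumes \<tau>: "toric_cone N \<tau>" and \<rho>: "\<rho> \<in> rays \<tau>"
  obtains s where "s \<in> N" "s \<noteq> 0" "\<rho> = convex_cone hull {s}"
proof -
  obtain S where S: "finite S" "S \<subseteq> N" "\<tau> = convex_cone hull S"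
    using \<tau> unfolding toric_cone_def by (elim conjE exE)
  have pointed: "\<forall>x. x \<in> \<tau> \<and> - x \<in> \<tau> \<longrightarrow> x = 0"
    using \<tau> by (simp add: toric_cone_def)
  have face: "\<rho> face_of \<tau>" and ne: "\<rho> \<noteq> {}" and dim: "dim \<rho> = 1"
    using \<rho> by (auto simp: rays_def cone_faces_def)
  have eq: "\<rho> = convex_cone hull (S \<inter> \<rho>)"
    using face_generated_by_contained_generators[of \<rho> S] face ne unfolding S(3) by simp
  have "\<exists>s\<in>S \<inter> \<rho>. s \<noteq> 0"
  proof (rule ccontr)
    assume "\<not> (\<exists>s\<in>S \<inter> \<rho>. s \<noteq> 0)"
    then have "convex_cone hull (S \<inter> \<rho>) \<subseteq> {0}" by (intro hull_minimal) auto
    with dim eq show False by (metis dim_eq_0 zero_neq_one)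
  qed
  then obtain s where s: "s \<in> S" "s \<in> \<rho>" "s \<noteq> 0" by blast
  have sub: "convex_cone hull {s} \<subseteq> \<rho>"
    using s by (subst eq) (intro hull_mono, auto)
  have span: "\<rho> \<subseteq> span {s}"
    using s dim by (intro card_ge_dim_independent) auto
  have "\<rho> \<subseteq> convex_cone hull {s}"
  proof
    fix y assume y: "y \<in> \<rho>"
    then obtain k where k: "y = k *\<^sub>R s" using span by (auto simp: span_singleton)
    show "y \<in> convex_cone hull {s}"
    proof (cases "0 \<le> k")
      case False
      then have "- y \<in> convex_cone hull {s}"
        using k by (auto simp: cone_hull_singleton intro!: exI[of _ "- k"])
      then have "y = 0" using sub y face face_of_imp_subset pointed by blast
      then show ?thesis by (simp add: convex_cone_hull_contains_0)
    qed (use k in \<open>auto simp: cone_hull_singleton\<close>)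
  qed
  then have "\<rho> = convex_cone hull {s}" using sub by (rule equalityI)
  moreover have "s \<in> N" using s(1) S(2) by (rule subsetD[rotated])
  ultimately show ?thesis using that s(3) by simp
qed

lemma ray_generator:
  assumes "is_lattice N" "toric_cone N \<tau>" "\<rho> \<in> rays \<tau>"
  shows "ray_generator N \<rho> \<in> N" "ray_generator N \<rho> \<in> \<rho>"
    "\<rho> = convex_cone hull {ray_generator N \<rho>}"
proof -
  let ?v = "ray_generator N \<rho>"
  obtain s where s: "s \<in> N" "s \<noteq> 0" "\<rho> = convex_cone hull {s}"
    using ray_spanned_by_lattice_vector assms by blast
  have v: "?v \<in> \<rho> \<and> primitive_in N ?v"
    unfolding ray_generator_def using theI'[OF ex1_primitive_in_ray[OF assms(1) s(1,2)]] s(3) by simp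
  then show "?v \<in> N" "?v \<in> \<rho>" by (auto simp: primitive_in_def)
  obtain t where t: "0 \<le> t" "?v = t *\<^sub>R s" using v s(3) by (auto simp: cone_hull_singleton)
  with v have "t \<noteq> 0" by (auto simp: primitive_in_def)
  with t have "s = (1 / t) *\<^sub>R ?v" "0 \<le> 1 / t" by auto
  then have "s \<in> convex_cone hull {?v}" unfolding cone_hull_singleton by blast
  then have "convex_cone hull {s} \<subseteq> convex_cone hull {?v}"
    by (intro hull_minimal) (auto simp: convex_cone_convex_cone_hull)
  moreover have "convex_cone hull {?v} \<subseteq> convex_cone hull {s}"
    using v s by (intro hull_minimal) (auto simp: convex_cone_convex_cone_hull)
  ultimately show "\<rho> = convex_cone hull {?v}" using s by simp
qed

lemma Gen_subset:
  assumes "is_lattice N" "toric_cone N \<tau>"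
  shows "Gen N \<tau> \<subseteq> N" "Gen N \<tau> \<subseteq> \<tau>"
proof -
  show "Gen N \<tau> \<subseteq> N" using ray_generator(1)[OF assms] by (auto simp: Gen_def)
  have "\<rho> \<subseteq> \<tau>" if "\<rho> \<in> rays \<tau>" for \<rho>
    using that face_of_imp_subset by (auto simp: rays_def cone_faces_def)
  then show "Gen N \<tau> \<subseteq> \<tau>" using ray_generator(2)[OF assms] by (auto simp: Gen_def)
qed

lemma toric_cone_eq_hull_Gen:
  assumes "is_lattice N" "toric_cone N \<tau>"
  shows "\<tau> = convex_cone hull (Gen N \<tau>)"
proof
  obtain S where S: "\<tau> = convex_cone hull S" "\<And>v. v \<in> S \<Longrightarrow> convex_cone hull {v} \<in> rays \<tau>"
    using toric_cone_generated_by_rays[OF assms(2)] by blast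
  have "v \<in> convex_cone hull (Gen N \<tau>)" if "v \<in> S" for v
  proof -
    let ?\<rho> = "convex_cone hull {v}"
    have "?\<rho> = convex_cone hull {ray_generator N ?\<rho>}"
      using ray_generator(3)[OF assms S(2)[OF that]] .
    also have "\<dots> \<subseteq> convex_cone hull (Gen N \<tau>)"
      using S(2)[OF that] by (intro hull_mono) (auto simp: Gen_def)
    finally show ?thesis using hull_inc[of v "{v}"] by blast
  qed
  then have "convex_cone hull S \<subseteq> convex_cone hull (Gen N \<tau>)"
    by (intro hull_minimal) (auto simp: convex_cone_convex_cone_hull)
  then show "\<tau> \<subseteq> convex_cone hull (Gen N \<tau>)" using S by simp
  show "convex_cone hull (Gen N \<tau>) \<subseteq> \<tau>"
    using Gen_subset[OF assms] toric_cone_convex_cone[OF assms(2)] by (intro hull_minimal)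
qed

lemma Gen_mono_face:
  assumes "\<tau>' face_of \<tau>"
  shows "Gen N \<tau>' \<subseteq> Gen N \<tau>"
proof -
  have "rays \<tau>' \<subseteq> rays \<tau>"
  proof
    fix \<rho> assume "\<rho> \<in> rays \<tau>'"
    then have "\<rho> face_of \<tau>'" "\<rho> \<noteq> {}" "dim \<rho> = 1" by (simp_all add: rays_def cone_faces_def)
    with face_of_trans[OF this(1) assms] show "\<rho> \<in> rays \<tau>"
      by (simp add: rays_def cone_faces_def)
  qed
  then show ?thesis unfolding Gen_def by (rule image_mono)
qed

lemma smooth_imp_simplicial:
  assumes "smooth_cone N \<tau>"
  shows "simplicial_cone N \<tau>"
proof -
  obtain B where "lattice_basis N B" and sub: "Gen N \<tau> \<subseteq> B"
    using assms unfolding smooth_cone_def by (elim exE conjE)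
  then have "independent B" unfolding lattice_basis_def by (elim conjE)
  from independent_mono[OF this sub] show ?thesis unfolding simplicial_cone_def .
qed

lemma smooth_cone_face:
  assumes "smooth_cone N \<tau>" "\<tau>' face_of \<tau>"
  shows "smooth_cone N \<tau>'"
proof -
  obtain B where "lattice_basis N B" "Gen N \<tau> \<subseteq> B"
    using assms(1) unfolding smooth_cone_def by (elim exE conjE)
  then show ?thesis
    using Gen_mono_face[OF assms(2), of N] unfolding smooth_cone_def by (metis order_trans)
qed

text \<open>
  On the simplex spanned by the origin and part of a lattice basis, each coordinate takes values
  in \<open>[0, 1]\<close> and the coordinates have sum at most \<open>1\<close>. A lattice point has integral
  coordinates, so it is a vertex.
\<close>

lemma smooth_imp_terminal:
  fixes N :: "'a::euclidean_space set"
  assumes N: "is_lattice N" and "toric_cone N \<tau>" and "smooth_cone N \<tau>"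
  shows "terminal_cone N \<tau>"
proof -
  let ?G = "Gen N \<tau>"
  obtain B where B: "lattice_basis N B" and GB: "?G \<subseteq> B"
    using assms(3) unfolding smooth_cone_def by blast
  have fin: "finite ?G" using GB lattice_basis_finite[OF B] finite_subset by blast
  have z: "0 \<notin> ?G"
    using B GB dependent_zero unfolding lattice_basis_def by blast
  have "x \<in> insert 0 ?G" if xN: "x \<in> N" and x: "x \<in> convex hull (insert 0 ?G)" for x
  proof -
    obtain u where u: "\<And>v. v \<in> insert 0 ?G \<Longrightarrow> 0 \<le> u v" "sum u (insert 0 ?G) = 1"
      "x = (\<Sum>v\<in>insert 0 ?G. u v *\<^sub>R v)"
      using x convex_hull_finite[of "insert 0 ?G"] fin by auto
    have x_eq: "x = (\<Sum>v\<in>?G. u v *\<^sub>R v)" using u(3) fin z by simp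
    have le: "sum u ?G \<le> 1" using u(2) u(1)[of 0] fin z by simp
    have int: "u v \<in> \<int>" if v: "v \<in> ?G" for v
    proof -
      obtain g :: "'a \<Rightarrow> real" where g: "linear g" "g v = 1"
        "\<And>b'. b' \<in> B \<Longrightarrow> b' \<noteq> v \<Longrightarrow> g b' = 0" "\<And>x. x \<in> N \<Longrightarrow> g x \<in> \<int>"
        using lattice_coordinate_functional[OF B] v GB by blast
      have "g x = (\<Sum>w\<in>?G. u w * g w)"
        unfolding x_eq using g(1) by (simp add: linear_sum linear_scale)
      also have "\<dots> = (\<Sum>w\<in>?G. if w = v then u v else 0)"
        using g GB by (intro sum.cong) auto
      also have "\<dots> = u v" using v fin by simp
      finally show ?thesis using g(4)[OF xN] by simp
    qed
    show ?thesis
    proof (cases "\<exists>v\<in>?G. u v \<noteq> 0")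
      case True
      then obtain v where v: "v \<in> ?G" "u v \<noteq> 0" by blast
      have "1 \<le> u v" using int[OF v(1)] u(1)[of v] v by (auto elim!: Ints_cases)
      have split: "sum u ?G = u v + sum u (?G - {v})" using v fin by (simp add: sum.remove)
      have nn: "0 \<le> u w" if "w \<in> ?G - {v}" for w using u(1) that by blast
      have "0 \<le> sum u (?G - {v})" using nn by (rule sum_nonneg)
      then have "u v = 1" "sum u (?G - {v}) = 0" using le split \<open>1 \<le> u v\<close> by linarith+
      then have "u w = 0" if "w \<in> ?G - {v}" for w
        using sum_nonneg_eq_0_iff[of "?G - {v}" u] nn fin that by auto
      then have "x = v"
        unfolding x_eq using v fin \<open>u v = 1\<close> by (simp add: sum.remove)
      then show ?thesis using v by simp
    qed (simp add: x_eq)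
  qed
  moreover have "insert 0 ?G \<subseteq> N" using lattice_zero[OF N] Gen_subset[OF assms(1,2)] by blast
  ultimately show ?thesis
    unfolding terminal_cone_def using hull_subset[of "insert 0 ?G" convex] by blast
qed

lemma nondegenerate_smooth_Gen_basis:
  fixes N :: "'a::euclidean_space set"
  assumes "is_lattice N" "toric_cone N \<tau>" "smooth_cone N \<tau>" "nondegenerate \<tau>"
  shows "lattice_basis N (Gen N \<tau>)"
proof -
  obtain B where B: "lattice_basis N B" and GB: "Gen N \<tau> \<subseteq> B"
    using assms(3) unfolding smooth_cone_def by blast
  have "convex_cone hull (Gen N \<tau>) \<subseteq> span (Gen N \<tau>)"
    by (intro hull_minimal) (auto simp: span_base convex_cone_span)
  then have "\<tau> \<subseteq> span (Gen N \<tau>)" using toric_cone_eq_hull_Gen[OF assms(1,2)] by simp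
  then have "DIM('a) \<le> dim (Gen N \<tau>)"
    using assms(4) unfolding nondegenerate_def by (metis dim_span dim_subset)
  then have full: "span (Gen N \<tau>) = UNIV"
    by (metis dim_eq_full dim_subset_UNIV le_antisym)
  have "B \<subseteq> Gen N \<tau>"
  proof
    fix b assume b: "b \<in> B"
    show "b \<in> Gen N \<tau>"
    proof (rule ccontr)
      assume "b \<notin> Gen N \<tau>"
      then have "Gen N \<tau> \<subseteq> B - {b}" using GB by blast
      then have "b \<in> span (B - {b})" using full span_mono by blast
      then show False using B b unfolding lattice_basis_def dependent_def by blast
    qed
  qed
  with GB B show ?thesis by (simp add: subset_antisym)
qed

text \<open>
  A form with value \<open>1\<close> on the generators exists because they are independent and is unique because
  they span, so the definite description in \<open>gen_form\<close> denotes it.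
\<close>

lemma gen_form:
  fixes N :: "'a::euclidean_space set"
  assumes "lattice_basis N (Gen N \<tau>)"
  shows "linear (gen_form N \<tau>)" "\<And>v. v \<in> Gen N \<tau> \<Longrightarrow> gen_form N \<tau> v = 1"
proof -
  have ind: "independent (Gen N \<tau>)" and full: "span (Gen N \<tau>) = UNIV"
    using assms by (auto simp: lattice_basis_def)
  have "\<exists>!l::'a \<Rightarrow> real. linear l \<and> (\<forall>v\<in>Gen N \<tau>. l v = 1)"
  proof (rule ex_ex1I)
    show "\<exists>l::'a \<Rightarrow> real. linear l \<and> (\<forall>v\<in>Gen N \<tau>. l v = 1)"
      using linear_independent_extend[OF ind, of "\<lambda>_. 1 :: real"] by blast
    fix l l' :: "'a \<Rightarrow> real"
    assume "linear l \<and> (\<forall>v\<in>Gen N \<tau>. l v = 1)" "linear l' \<and> (\<forall>v\<in>Gen N \<tau>. l' v = 1)"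
    then show "l = l'"
      using linear_eq_on[of l l' _ "Gen N \<tau>"] full by (intro ext) auto
  qed
  from theI'[OF this] show "linear (gen_form N \<tau>)"
    "\<And>v. v \<in> Gen N \<tau> \<Longrightarrow> gen_form N \<tau> v = 1"
    unfolding gen_form_def by blast+
qed

section \<open>Full-dimensional cones of a subdivision\<close>

text \<open>
  The lower-dimensional cones form a null set, so the closed union of the nondegenerate ones
  contains the interior of \<open>\<sigma>\<close>, and \<open>\<sigma>\<close> is the closure of its interior.
\<close>

lemma subdivision_covered_by_nondegenerate:
  fixes \<sigma> :: "'a::euclidean_space set"
  assumes "toric_cone N \<sigma>" "nondegenerate \<sigma>" "subdivision N \<sigma> \<Sigma>" "x \<in> \<sigma>"
  obtains \<tau> where "\<tau> \<in> \<Sigma>" "nondegenerate \<tau>" "x \<in> \<tau>"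
proof -
  define U where "U = \<Union>{\<tau> \<in> \<Sigma>. nondegenerate \<tau>}"
  have fin: "finite \<Sigma>" and cones: "\<And>\<tau>. \<tau> \<in> \<Sigma> \<Longrightarrow> toric_cone N \<tau>" and un: "\<Union>\<Sigma> = \<sigma>"
    using assms(3) by (auto simp: subdivision_def fan_def)
  have "closed U" unfolding U_def using fin cones toric_cone_closed
    by (intro closed_Union) auto
  have "negligible (\<Union>{\<tau> \<in> \<Sigma>. \<not> nondegenerate \<tau>})"
  proof (rule negligible_Union)
    fix \<tau> assume "\<tau> \<in> {\<tau> \<in> \<Sigma>. \<not> nondegenerate \<tau>}"
    then show "negligible \<tau>"
      using dim_subset_UNIV[of \<tau>] by (intro negligible_lowdim) (auto simp: nondegenerate_def)
  qed (use fin in auto)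
  moreover have "interior \<sigma> - U \<subseteq> \<Union>{\<tau> \<in> \<Sigma>. \<not> nondegenerate \<tau>}"
    using un interior_subset[of \<sigma>] by (auto simp: U_def)
  ultimately have "negligible (interior \<sigma> - U)" by (rule negligible_subset)
  moreover have "open (interior \<sigma> - U)" using \<open>closed U\<close> by blast
  ultimately have "interior \<sigma> \<subseteq> U" using open_not_negligible by blast
  have con: "convex_cone \<sigma>" using assms(1) by (rule toric_cone_convex_cone)
  have "convex \<sigma>" "\<sigma> \<noteq> {}" "0 \<in> \<sigma>" using con convex_cone_contains_0 by (auto simp: convex_cone_def)
  have "aff_dim \<sigma> = int DIM('a)"
    using aff_dim_zero[of \<sigma>] \<open>0 \<in> \<sigma>\<close> assms(2) by (simp add: nondegenerate_def hull_inc)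
  then have "interior \<sigma> \<noteq> {}"
    using interior_rel_interior_gen[of \<sigma>] rel_interior_eq_empty \<open>convex \<sigma>\<close> \<open>\<sigma> \<noteq> {}\<close> by auto
  then have "\<sigma> \<subseteq> closure (interior \<sigma>)"
    using convex_closure_interior[OF \<open>convex \<sigma>\<close>] closure_subset by blast
  also have "\<dots> \<subseteq> U" using \<open>interior \<sigma> \<subseteq> U\<close> \<open>closed U\<close> by (rule closure_minimal)
  finally show ?thesis using assms(4) that by (auto simp: U_def)
qed

text \<open>
  A point in the relative interior of a cone of the fan lies in some nondegenerate cone; the
  intersection of the two is a face of the first that meets its relative interior, hence all of it.
\<close>

lemma fan_cone_face_of_nondegenerate:
  fixes \<sigma> :: "'a::euclidean_space set"
  assumes "toric_cone N \<sigma>" "nondegenerate \<sigma>" "subdivision N \<sigma> \<Sigma>" "\<tau>' \<in> \<Sigma>"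
  obtains \<tau> where "\<tau> \<in> \<Sigma>" "nondegenerate \<tau>" "\<tau>' face_of \<tau>"
proof -
  have "toric_cone N \<tau>'" using assms by (auto simp: subdivision_def fan_def)
  then have "convex \<tau>'" "\<tau>' \<noteq> {}" using toric_cone_convex_cone by (auto simp: convex_cone_def)
  then obtain x where x: "x \<in> rel_interior \<tau>'" using rel_interior_eq_empty by blast
  then have "x \<in> \<sigma>" using assms rel_interior_subset by (auto simp: subdivision_def)
  then obtain \<tau> where \<tau>: "\<tau> \<in> \<Sigma>" "nondegenerate \<tau>" "x \<in> \<tau>"
    using subdivision_covered_by_nondegenerate[OF assms(1-3)] by blast
  have "\<tau>' \<inter> \<tau> face_of \<tau>'" "\<tau>' \<inter> \<tau> face_of \<tau>"
    using assms(3,4) \<tau> by (auto simp: subdivision_def fan_def cone_faces_def)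
  moreover have "\<tau>' \<inter> \<tau> = \<tau>'"
  proof
    have "x \<in> (\<tau>' \<inter> \<tau>) \<inter> rel_interior \<tau>'"
      using x \<tau>(3) subsetD[OF rel_interior_subset x] by simp
    then show "\<tau>' \<subseteq> \<tau>' \<inter> \<tau>"
      by (intro subset_of_face_of[OF calculation(1)]) auto
  qed simp
  ultimately have "\<tau>' face_of \<tau>" by simp
  with \<tau> show ?thesis by (intro that)
qed

section \<open>Generators of a moderate resolution and the bounded faces\<close>

lemma functional_meeting_rays_dominates_norm:
  fixes \<sigma> :: "'a::euclidean_space set"
  assumes \<sigma>: "toric_cone N \<sigma>"
    and l: "linear l" and meets: "\<And>\<rho>. \<rho> \<in> rays \<sigma> \<Longrightarrow> {x. l x = (1::real)} \<inter> \<rho> \<noteq> {}"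
  obtains K where "0 < K" "\<And>x. x \<in> \<sigma> \<Longrightarrow> norm x \<le> K * l x"
proof -
  obtain S where S: "finite S" "S \<subseteq> N" "\<sigma> = convex_cone hull S"
    "\<And>v. v \<in> S \<Longrightarrow> convex_cone hull {v} \<in> rays \<sigma>"
    using toric_cone_generated_by_rays[OF \<sigma>] by blast
  have "0 < l v" if v: "v \<in> S" for v
  proof -
    obtain t where "0 \<le> t" "l (t *\<^sub>R v) = 1"
      using meets[OF S(4)[OF v]] by (auto simp: cone_hull_singleton)
    then have "t * l v = 1" using l by (simp add: linear_scale)
    with \<open>0 \<le> t\<close> show ?thesis by (metis mult_nonneg_nonpos not_le zero_less_one)
  qed
  from positive_functional_dominates_norm[OF S(1) l this]
  obtain K where "0 < K" "\<And>x. x \<in> convex_cone hull S \<Longrightarrow> norm x \<le> K * l x" by blast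
  then show ?thesis unfolding S(3)[symmetric] by (rule that)
qed

text \<open>
  The bounded face is the one cut out by \<open>l = 1\<close>, where \<open>l\<close> is the form of \<open>\<tau>\<close>: an integral and
  positive value at a lattice point is at least \<open>1\<close>.
\<close>

lemma moderate_Gen_in_bounded_face:
  fixes \<sigma> :: "'a::euclidean_space set"
  assumes N: "is_lattice N" and \<sigma>: "toric_cone N \<sigma>"
    and M: "moderate_toric_resolution N \<sigma> \<Sigma>" and \<tau>: "\<tau> \<in> \<Sigma>" "nondegenerate \<tau>"
  obtains F where "F \<in> bounded_faces N \<sigma>" "Gen N \<tau> \<subseteq> F"
proof -
  define l where "l = gen_form N \<tau>"
  define P where "P = convex hull (\<sigma> \<inter> N - {0})"
  define F where "F = P \<inter> {x. l x = 1}"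
  have \<tau>cone: "toric_cone N \<tau>" and "\<tau> \<subseteq> \<sigma>"
    using M \<tau> by (auto simp: moderate_toric_resolution_def subdivision_def fan_def)
  have "smooth_cone N \<tau>" and meets: "\<And>\<rho>. \<rho> \<in> rays \<sigma> \<Longrightarrow> {x. l x = 1} \<inter> \<rho> \<noteq> {}"
    using M \<tau> by (auto simp: moderate_toric_resolution_def l_def)
  then have basis: "lattice_basis N (Gen N \<tau>)"
    using nondegenerate_smooth_Gen_basis[OF N \<tau>cone _ \<tau>(2)] by blast
  have l: "linear l" "\<And>v. v \<in> Gen N \<tau> \<Longrightarrow> l v = 1"
    using gen_form[OF basis] by (auto simp: l_def)
  obtain K where K: "0 < K" "\<And>x. x \<in> \<sigma> \<Longrightarrow> norm x \<le> K * l x"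
    using functional_meeting_rays_dominates_norm[OF \<sigma> l(1) meets] by blast
  have "1 \<le> l x" if x: "x \<in> \<sigma> \<inter> N - {0}" for x
  proof -
    have "l x \<in> \<int>" using linear_Ints_on_lattice[OF basis l(1)] l(2) x by simp
    moreover have "0 < norm x" "norm x \<le> K * l x" using x K(2) by auto
    then have "0 < l x" using K(1) by (metis less_le_trans zero_less_mult_pos)
    ultimately show ?thesis by (auto elim!: Ints_cases)
  qed
  then have "P \<subseteq> l -` {1..}"
    unfolding P_def using convex_linear_vimage[OF l(1), of "{1..}"]
    by (intro hull_minimal) auto
  then have ge: "1 \<le> l x" if "x \<in> P" for x using that by auto
  have "P \<subseteq> \<sigma>" unfolding P_def
    using toric_cone_convex_cone[OF \<sigma>] by (intro hull_minimal) (auto simp: convex_cone_def)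
  have conv: "convex P" by (simp add: P_def convex_convex_hull)
  have "F face_of P"
    unfolding face_of_def
  proof (intro conjI ballI impI)
    show "F \<subseteq> P" by (auto simp: F_def)
    have "convex (l -` {1})" using l(1) by (intro convex_linear_vimage) auto
    then show "convex F" using conv unfolding F_def vimage_def by (auto intro: convex_Int)
    fix a b x assume a: "a \<in> P" and b: "b \<in> P" and "x \<in> F" "x \<in> open_segment a b"
    then obtain u where u: "0 < u" "u < 1" "x = (1 - u) *\<^sub>R a + u *\<^sub>R b" and "l x = 1"
      by (auto simp: in_segment F_def)
    have "l x = (1 - u) * l a + u * l b"
      unfolding u(3) using l(1) by (simp add: linear_add linear_scale)
    with \<open>l x = 1\<close> have eq: "(1 - u) * (l a - 1) + u * (l b - 1) = 0"
      by (simp add: algebra_simps)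
    have "0 \<le> (1 - u) * (l a - 1)" "0 \<le> u * (l b - 1)" using u ge a b by simp_all
    with eq have "(1 - u) * (l a - 1) = 0" "u * (l b - 1) = 0" by linarith+
    then show "a \<in> F" "b \<in> F" using u a b by (auto simp: F_def)
  qed
  moreover have "bounded F"
    using K(2) \<open>P \<subseteq> \<sigma>\<close> by (intro boundedI[of _ K]) (force simp: F_def)
  moreover have sub: "Gen N \<tau> \<subseteq> F"
  proof
    fix v assume v: "v \<in> Gen N \<tau>"
    then have "l v = 1" by (rule l)
    moreover from this have "v \<noteq> 0" using l(1) linear_0 by force
    then have "v \<in> \<sigma> \<inter> N - {0}"
      using v Gen_subset[OF N \<tau>cone] \<open>\<tau> \<subseteq> \<sigma>\<close> by blast
    then have "v \<in> P" unfolding P_def by (rule hull_inc)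
    ultimately show "v \<in> F" by (simp add: F_def)
  qed
  moreover have "Gen N \<tau> \<noteq> {}"
    using basis by (force simp: lattice_basis_def)
  ultimately show ?thesis
    using that[of F] by (auto simp: bounded_faces_def P_def)
qed

lemma canonical_fan_subset:
  assumes "toric_cone N \<sigma>" "\<kappa> \<in> canonical_fan N \<sigma>"
  shows "\<kappa> \<subseteq> \<sigma>"
proof -
  have con: "convex_cone \<sigma>" using assms(1) by (rule toric_cone_convex_cone)
  have "convex hull (\<sigma> \<inter> N - {0}) \<subseteq> \<sigma>"
    using con by (intro hull_minimal) (auto simp: convex_cone_def)
  have "convex_cone hull F \<subseteq> \<sigma>" if "F \<in> bounded_faces N \<sigma>" for F
  proof (rule hull_minimal)
    have "F face_of convex hull (\<sigma> \<inter> N - {0})" using that by (simp add: bounded_faces_def)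
    then show "F \<subseteq> \<sigma>" using \<open>convex hull (\<sigma> \<inter> N - {0}) \<subseteq> \<sigma>\<close> face_of_imp_subset by fast
  qed (rule con)
  then show ?thesis
    using assms(2) convex_cone_contains_0[OF con] by (auto simp: canonical_fan_def)
qed

theorem theorem1p7:
  fixes N :: "'a::euclidean_space set"
    and \<sigma> :: "'a set"
    and \<Sigma> :: "'a set set"
  assumes "DIM('a) = 3"
    and "is_lattice N"
    and "toric_cone N \<sigma>"
    and "nondegenerate \<sigma>"
    and "moderate_toric_resolution N \<sigma> \<Sigma>"
  shows "minimal_terminal_model N \<sigma> \<Sigma>"
proof -
  have sub: "subdivision N \<sigma> \<Sigma>" using assms(5) by (simp add: moderate_toric_resolution_def)
  then have fan: "fan N \<Sigma>" and un: "\<Union>\<Sigma> = \<sigma>" by (auto simp: subdivision_def)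
  have cone: "toric_cone N \<tau>" if "\<tau> \<in> \<Sigma>" for \<tau> using fan that by (auto simp: fan_def)
  have smooth_bounded: "smooth_cone N \<tau> \<and> (\<exists>F\<in>bounded_faces N \<sigma>. Gen N \<tau> \<subseteq> F)" if \<tau>: "\<tau> \<in> \<Sigma>" for \<tau>
  proof -
    obtain \<tau>' where \<tau>': "\<tau>' \<in> \<Sigma>" "nondegenerate \<tau>'" "\<tau> face_of \<tau>'"
      by (rule fan_cone_face_of_nondegenerate[OF assms(3,4) sub \<tau>])
    have "smooth_cone N \<tau>'" using assms(5) \<tau>' by (simp add: moderate_toric_resolution_def)
    then have "smooth_cone N \<tau>" using \<tau>'(3) by (rule smooth_cone_face)
    moreover obtain F where F: "F \<in> bounded_faces N \<sigma>" "Gen N \<tau>' \<subseteq> F"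
      by (rule moderate_Gen_in_bounded_face[OF assms(2,3,5) \<tau>'(1,2)])
    moreover have "Gen N \<tau> \<subseteq> F" using Gen_mono_face[OF \<tau>'(3)] F(2) by (rule order_trans)
    ultimately show ?thesis by blast
  qed
  have inside: "\<exists>\<kappa>\<in>canonical_fan N \<sigma>. \<tau> \<subseteq> \<kappa>" if \<tau>: "\<tau> \<in> \<Sigma>" for \<tau>
  proof -
    obtain F where F: "F \<in> bounded_faces N \<sigma>" "Gen N \<tau> \<subseteq> F" using smooth_bounded[OF \<tau>] by blast
    have "\<tau> = convex_cone hull (Gen N \<tau>)"
      using toric_cone_eq_hull_Gen[OF assms(2) cone[OF \<tau>]] .
    also have "\<dots> \<subseteq> convex_cone hull F" using F(2) by (rule hull_mono)
    finally show ?thesis using F(1) by (auto simp: canonical_fan_def)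
  qed
  have "\<Union>\<Sigma> = \<Union>(canonical_fan N \<sigma>)"
    using inside canonical_fan_subset[OF assms(3)] un by blast
  then have "fan_subdivision N (canonical_fan N \<sigma>) \<Sigma>"
    using fan inside by (simp add: fan_subdivision_def)
  moreover have "simplicial_cone N \<tau> \<and> terminal_cone N \<tau> \<and> Gen N \<tau> \<subseteq> \<Union>(bounded_faces N \<sigma>)"
    if "\<tau> \<in> \<Sigma>" for \<tau>
  proof -
    have "smooth_cone N \<tau>" and "Gen N \<tau> \<subseteq> \<Union>(bounded_faces N \<sigma>)"
      using smooth_bounded[OF that] by auto
    then show ?thesis
      using smooth_imp_simplicial smooth_imp_terminal[OF assms(2) cone[OF that]] by simp
  qed
  ultimately show ?thesis by (simp add: minimal_terminal_model_def)
qed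

end
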